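(* Let $\Psi=\Psi(s,t)$ be a solution of the Betchov-Da Rios equation $\Psi_t=\Psi_s\times\Psi_{ss}\times\Psi_{sss}$ in $E^4$ such that the $s$-parameter curve $s\mapsto\Psi(s,t)$ is unit speed for all $t$, with parallel transport frame field $\{\mathcal{T},\mathcal{P}_1,\mathcal{P}_2,\mathcal{P}_3\}$ and curvature functions $k_1,k_2,k_3$. Then the derivative formulas of the parallel transport frame field are $$\begin{bmatrix}\mathcal{T}_s\\(\mathcal{P}_1)_s\\(\mathcal{P}_2)_s\\(\mathcal{P}_3)_s\end{bmatrix}=\begin{bmatrix}0&k_1&k_2&k_3\\-k_1&0&0&0\\-k_2&0&0&0\\-k_3&0&0&0\end{bmatrix}\begin{bmatrix}\mathcal{T}\\\mathcal{P}_1\\\mathcal{P}_2\\\mathcal{P}_3\end{bmatrix}$$ and $$\begin{bmatrix}\mathcal{T}_t\\(\mathcal{P}_1)_t\\(\mathcal{P}_2)_t\\(\mathcal{P}_3)_t\end{bmatrix}=\begin{bmatrix}0&\mathfrak{a}_{12}&\mathfrak{a}_{13}&\mathfrak{a}_{14}\\-\mathfrak{a}_{12}&0&\mathfrak{a}_{23}&\mathfrak{a}_{24}\\-\mathfrak{a}_{13}&-\mathfrak{a}_{23}&0&\mathfrak{a}_{34}\\-\mathfrak{a}_{14}&-\mathfrak{a}_{24}&-\mathfrak{a}_{34}&0\end{bmatrix}\begin{bmatrix}\mathcal{T}\\\mathcal{P}_1\\\mathcal{P}_2\\\mathcal{P}_3\end{bmatrix},$$ where $$\mathfrak{a}_{12}=k_3(k_2)_{ss}-k_2(k_3)_{ss},\quad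 \mathfrak{a}_{13}=k_1(k_3)_{ss}-k_3(k_1)_{ss},\quad \mathfrak{a}_{14}=k_2(k_1)_{ss}-k_1(k_2)_{ss},$$ $$\mathfrak{a}_{23}=\int\Big(k_3\big(k_1(k_1)_{ss}+k_2(k_2)_{ss}\big)-(k_3)_{ss}(k_1^2+k_2^2)\Big)ds,$$ $$\mathfrak{a}_{24}=\int\Big(-k_2\big(k_1(k_1)_{ss}+k_3(k_3)_{ss}\big)+(k_2)_{ss}(k_1^2+k_3^2)\Big)ds,$$ $$\mathfrak{a}_{34}=\int\Big(k_1\big(k_2(k_2)_{ss}+k_3(k_3)_{ss}\big)-(k_1)_{ss}(k_2^2+k_3^2)\Big)ds.$$ Here $f=\int g\,ds$ means that $f$ is an antiderivative of $g$ in the variable $s$, i.e. $f_s=g$.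
   Context: Setting. $E^4$ is $\mathbb{R}^4$ with its standard inner product $\langle\cdot,\cdot\rangle$ and orientation; the ternary vector product $x\times y\times z$ is the formal determinant of the $4\times4$ matrix whose first row is the standard basis $(e_1,e_2,e_3,e_4)$ and whose remaining rows are $x,y,z$. Subscripts $s,t$ denote partial derivatives. $\Psi=\Psi(s,t)$ is a smooth map from a product of two open intervals to $E^4$. A parallel transport frame field of the unit speed $s$-parameter curves is a smooth (in $(s,t)$) positively oriented orthonormal frame $\{\mathcal{T},\mathcal{P}_1,\mathcal{P}_2,\mathcal{P}_3\}$ along $\Psi$ with $\mathcal{T}=\Psi_s$ and each $(\mathcal{P}_i)_s$ a multiple of $\mathcal{T}$; its curvature functions are $k_i=\langle\mathcal{T}_s,\mathcal{P}_i\rangle$, $i=1,2,3$. Standing assumptions: at least two of $k_1,k_2,k_3$ are non-zero, and the functions $P=k_3(k_2)_s-k_2(k_3)_s$, $R=k_1(k_3)_s-k_3(k_1)_s$, $S=k_2(k_1)_s-k_1(k_2)_s$ are not all zero at any point. *)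

theory Defs
  imports "HOL-Analysis.Analysis"
begin

text \<open>\<open>C\<^sup>n\<close> and \<open>C\<^sup>\<infinity>\<close> maps on an open set: all iterated directional derivatives up to
  order \<open>n\<close> exist as Frechet derivatives and are continuous. Only meaningful for open \<open>S\<close>.\<close>

primrec C_on :: "nat \<Rightarrow> ('a::real_normed_vector \<Rightarrow> 'b::real_normed_vector) \<Rightarrow> 'a set \<Rightarrow> bool" where
  "C_on 0 f S \<longleftrightarrow> continuous_on S f"
| "C_on (Suc n) f S \<longleftrightarrow>
     (\<forall>x\<in>S. f differentiable (at x)) \<and>
     (\<forall>v. C_on n (\<lambda>x. frechet_derivative f (at x) v) S)"

definition smooth_on :: "('a::real_normed_vector \<Rightarrow> 'b::real_normed_vector) \<Rightarrow> 'a set \<Rightarrow> bool" where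
  "smooth_on f S \<longleftrightarrow> (\<forall>n. C_on n f S)"

definition ds :: "(real \<Rightarrow> real \<Rightarrow> 'a::real_normed_vector) \<Rightarrow> real \<Rightarrow> real \<Rightarrow> 'a" where
  "ds f s t = vector_derivative (\<lambda>x. f x t) (at s)"

definition dt :: "(real \<Rightarrow> real \<Rightarrow> 'a::real_normed_vector) \<Rightarrow> real \<Rightarrow> real \<Rightarrow> 'a" where
  "dt f s t = vector_derivative (\<lambda>y. f s y) (at t)"

text \<open>The formal determinant with first row \<open>(e\<^sub>1, e\<^sub>2, e\<^sub>3, e\<^sub>4)\<close> and remaining rows \<open>x, y, z\<close>:
  its \<open>i\<close>-th coordinate is obtained by replacing each symbol \<open>e\<^sub>j\<close> by the \<open>i\<close>-th coordinate of
  the vector \<open>e\<^sub>j\<close>, so that the first row becomes \<open>axis i 1\<close>.\<close>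

definition ternary_cross :: "real^4 \<Rightarrow> real^4 \<Rightarrow> real^4 \<Rightarrow> real^4" where
  "ternary_cross x y z = (\<chi> i. det (vector [axis i 1, x, y, z] :: real^4^4))"

definition betchov_da_rios :: "real set \<Rightarrow> real set \<Rightarrow> (real \<Rightarrow> real \<Rightarrow> real^4) \<Rightarrow> bool" where
  "betchov_da_rios I J \<Psi> \<longleftrightarrow>
     (\<forall>s\<in>I. \<forall>t\<in>J. dt \<Psi> s t = ternary_cross (ds \<Psi> s t) (ds (ds \<Psi>) s t) (ds (ds (ds \<Psi>)) s t))"

text \<open>A quadruple of vectors is regarded as the matrix with these vectors as rows.\<close>

definition pos_orthonormal :: "real^4 \<Rightarrow> real^4 \<Rightarrow> real^4 \<Rightarrow> real^4 \<Rightarrow> bool" where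
  "pos_orthonormal u v w x \<longleftrightarrow>
     (let F = vector [u, v, w, x] :: real^4^4
      in (\<forall>i j. F $ i \<bullet> F $ j = (if i = j then 1 else 0)) \<and> det F > 0)"

definition parallel_transport_frame ::
  "real set \<Rightarrow> real set \<Rightarrow> (real \<Rightarrow> real \<Rightarrow> real^4) \<Rightarrow> (real \<Rightarrow> real \<Rightarrow> real^4) \<Rightarrow>
   (real \<Rightarrow> real \<Rightarrow> real^4) \<Rightarrow> (real \<Rightarrow> real \<Rightarrow> real^4) \<Rightarrow> (real \<Rightarrow> real \<Rightarrow> real^4) \<Rightarrow> bool" where
  "parallel_transport_frame I J \<Psi> T P\<^sub>1 P\<^sub>2 P\<^sub>3 \<longleftrightarrow>
     (\<forall>V\<in>{T, P\<^sub>1, P\<^sub>2, P\<^sub>3}. smooth_on (\<lambda>(s, t). V s t) (I \<times> J)) \<and>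
     (\<forall>s\<in>I. \<forall>t\<in>J.
        pos_orthonormal (T s t) (P\<^sub>1 s t) (P\<^sub>2 s t) (P\<^sub>3 s t) \<and>
        T s t = ds \<Psi> s t \<and>
        (\<forall>P\<in>{P\<^sub>1, P\<^sub>2, P\<^sub>3}. \<exists>c. ds P s t = c *\<^sub>R T s t))"

end

theory Submission
  imports Defs
begin

text \<open>The components of the \<open>t\<close>-derivatives of the frame in the frame itself form a skew matrix
  because the frame is orthonormal. By the equation, the components of \<open>\<Psi>\<^sub>t\<close> along
  \<open>\<P>\<^sub>1, \<P>\<^sub>2, \<P>\<^sub>3\<close> are the functions \<open>P, R, S\<close>, and the component along \<open>\<T>\<close> vanishes. Since
  \<open>\<T>\<^sub>t = (\<Psi>\<^sub>t)\<^sub>s\<close> and \<open>(\<P>\<^sub>i)\<^sub>s\<close> is parallel to \<open>\<T>\<close>, the components of \<open>\<T>\<^sub>t\<close> are \<open>P\<^sub>s, R\<^sub>s, S\<^sub>s\<close>.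
  Exchanging the partial derivatives of \<open>\<P>\<^sub>i\<close> then shows that
  \<open>\<langle>(\<P>\<^sub>i)\<^sub>t, \<P>\<^sub>j\<rangle>\<^sub>s = k\<^sub>j \<langle>\<T>\<^sub>t, \<P>\<^sub>i\<rangle> - k\<^sub>i \<langle>\<T>\<^sub>t, \<P>\<^sub>j\<rangle>\<close>.\<close>

section \<open>Smooth maps and their partial derivatives\<close>

text \<open>On an open set a Frechet derivative depends only on nearby values, so agreement passes
  to the directional derivatives. The induction on the order therefore keeps \<open>f\<close> and
  \<open>g\<close> arbitrary.\<close>

lemma C_on_cong:
  assumes "open S" "\<And>x. x \<in> S \<Longrightarrow> f x = g x" "C_on n f S"
  shows "C_on n g S"
  using assms(2,3)
proof (induction n arbitrary: f g)
  case 0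
  then show ?case by (simp cong: continuous_on_cong)
next
  case (Suc n)
  have der: "(g has_derivative frechet_derivative f (at x)) (at x)" if "x \<in> S" for x
    using Suc.prems that \<open>open S\<close>
    by (auto simp: frechet_derivative_works intro: has_derivative_transform_within_open)
  have eq: "frechet_derivative f (at x) = frechet_derivative g (at x)" if "x \<in> S" for x
    using der[OF that] by (rule frechet_derivative_at)
  have "C_on n (\<lambda>x. frechet_derivative g (at x) v) S" for v
    by (rule Suc.IH[where f = "\<lambda>x. frechet_derivative f (at x) v"])
      (use Suc.prems(2) eq in auto)
  then show ?case
    using der by (auto simp: differentiable_def)
qed

lemma smooth_on_cong:
  assumes "open S" "\<And>x. x \<in> S \<Longrightarrow> f x = g x" "smooth_on f S"
  shows "smooth_on g S"
  using assms C_on_cong unfolding smooth_on_def by blast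

lemma smooth_on_imp_continuous_on: "smooth_on f S \<Longrightarrow> continuous_on S f"
  unfolding smooth_on_def by (metis C_on.simps(1))

lemma smooth_on_has_derivative:
  assumes "smooth_on f S" "x \<in> S"
  shows "(f has_derivative frechet_derivative f (at x)) (at x)"
  using assms unfolding smooth_on_def frechet_derivative_works[symmetric]
  by (metis C_on.simps(2))

lemma smooth_on_frechet_derivative:
  "smooth_on f S \<Longrightarrow> smooth_on (\<lambda>x. frechet_derivative f (at x) v) S"
  unfolding smooth_on_def by (metis C_on.simps(2))

lemma ds_eqI: "((\<lambda>x. f x t) has_vector_derivative d) (at s) \<Longrightarrow> ds f s t = d"
  unfolding ds_def by (rule vector_derivative_at)

lemma dt_eqI: "((\<lambda>y. f s y) has_vector_derivative d) (at t) \<Longrightarrow> dt f s t = d"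
  unfolding dt_def by (rule vector_derivative_at)

text \<open>Chain rule along the line of points \<open>(x, t)\<close>, then linearity of the
  derivative. This links the one-variable derivative in \<open>ds\<close> to the directional
  derivatives in \<open>C_on\<close>.\<close>

lemma has_vector_derivative_frechet_ds:
  assumes "smooth_on (\<lambda>(s, t). f s t) (I \<times> J)" "s \<in> I" "t \<in> J"
  shows "((\<lambda>x. f x t) has_vector_derivative
    frechet_derivative (\<lambda>(s, t). f s t) (at (s, t)) (1, 0)) (at s)"
proof -
  let ?D = "frechet_derivative (\<lambda>(s, t). f s t) (at (s, t))"
  have D: "((\<lambda>(s, t). f s t) has_derivative ?D) (at (s, t))"
    using assms by (intro smooth_on_has_derivative) auto
  have "((\<lambda>x. (x, t)) has_derivative (\<lambda>h. (h, 0))) (at s)"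
    by (auto intro!: derivative_eq_intros)
  from diff_chain_at[OF this D]
  have "((\<lambda>x. f x t) has_derivative (\<lambda>h. ?D (h, 0))) (at s)"
    by (simp add: o_def)
  moreover have "(\<lambda>h. ?D (h, 0)) = (\<lambda>h. h *\<^sub>R ?D (1, 0))"
  proof
    show "?D (h, 0) = h *\<^sub>R ?D (1, 0)" for h
      using linear_scale[OF has_derivative_linear[OF D], of h "(1, 0)"] by simp
  qed
  ultimately show ?thesis
    unfolding has_vector_derivative_def by (rule has_derivative_eq_rhs)
qed

lemma has_vector_derivative_frechet_dt:
  assumes "smooth_on (\<lambda>(s, t). f s t) (I \<times> J)" "s \<in> I" "t \<in> J"
  shows "((\<lambda>y. f s y) has_vector_derivative
    frechet_derivative (\<lambda>(s, t). f s t) (at (s, t)) (0, 1)) (at t)"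
proof -
  let ?D = "frechet_derivative (\<lambda>(s, t). f s t) (at (s, t))"
  have D: "((\<lambda>(s, t). f s t) has_derivative ?D) (at (s, t))"
    using assms by (intro smooth_on_has_derivative) auto
  have "((\<lambda>y. (s, y)) has_derivative (\<lambda>h. (0, h))) (at t)"
    by (auto intro!: derivative_eq_intros)
  from diff_chain_at[OF this D]
  have "((\<lambda>y. f s y) has_derivative (\<lambda>h. ?D (0, h))) (at t)"
    by (simp add: o_def)
  moreover have "(\<lambda>h. ?D (0, h)) = (\<lambda>h. h *\<^sub>R ?D (0, 1))"
  proof
    show "?D (0, h) = h *\<^sub>R ?D (0, 1)" for h
      using linear_scale[OF has_derivative_linear[OF D], of h "(0, 1)"] by simp
  qed
  ultimately show ?thesis
    unfolding has_vector_derivative_def by (rule has_derivative_eq_rhs)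
qed

lemma smooth_on_has_ds:
  assumes "smooth_on (\<lambda>(s, t). f s t) (I \<times> J)" "s \<in> I" "t \<in> J"
  shows "((\<lambda>x. f x t) has_vector_derivative ds f s t) (at s)"
  using has_vector_derivative_frechet_ds[OF assms]
    ds_eqI[of f, OF has_vector_derivative_frechet_ds[OF assms]] by simp

lemma smooth_on_has_dt:
  assumes "smooth_on (\<lambda>(s, t). f s t) (I \<times> J)" "s \<in> I" "t \<in> J"
  shows "((\<lambda>y. f s y) has_vector_derivative dt f s t) (at t)"
  using has_vector_derivative_frechet_dt[OF assms]
    dt_eqI[of f, OF has_vector_derivative_frechet_dt[OF assms]] by simp

text \<open>\<open>ds f\<close> is identified with the directional derivative along
  \<open>(1, 0)\<close> only on \<open>I \<times> J\<close>, hence the detour through congruence on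
  an open set.\<close>

lemma smooth_on_ds:
  assumes "open I" "open J" and f: "smooth_on (\<lambda>(s, t). f s t) (I \<times> J)"
  shows "smooth_on (\<lambda>(s, t). ds f s t) (I \<times> J)"
proof (rule smooth_on_cong[OF _ _ smooth_on_frechet_derivative[OF f, of "(1, 0)"]])
  show "open (I \<times> J)"
    using assms by (simp add: open_Times)
  fix x assume "x \<in> I \<times> J"
  then show "frechet_derivative (\<lambda>(s, t). f s t) (at x) (1, 0) = (case x of (s, t) \<Rightarrow> ds f s t)"
    using ds_eqI[of f, OF has_vector_derivative_frechet_ds[OF f]] by auto
qed

lemma smooth_on_dt:
  assumes "open I" "open J" and f: "smooth_on (\<lambda>(s, t). f s t) (I \<times> J)"
  shows "smooth_on (\<lambda>(s, t). dt f s t) (I \<times> J)"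
proof (rule smooth_on_cong[OF _ _ smooth_on_frechet_derivative[OF f, of "(0, 1)"]])
  show "open (I \<times> J)"
    using assms by (simp add: open_Times)
  fix x assume "x \<in> I \<times> J"
  then show "frechet_derivative (\<lambda>(s, t). f s t) (at x) (0, 1) = (case x of (s, t) \<Rightarrow> dt f s t)"
    using dt_eqI[of f, OF has_vector_derivative_frechet_dt[OF f]] by auto
qed

text \<open>Differentiate \<open>f(x, y) = f(a, y) + \<integral>\<^sub>a\<^sup>x f\<^sub>s(u, y) du\<close> with respect to \<open>y\<close> under the integral
  sign and then with respect to \<open>x\<close>.\<close>

lemma mixed_partial_derivative:
  fixes f :: "real \<Rightarrow> real \<Rightarrow> 'a::banach"
  assumes I: "open I" "is_interval I" and J: "open J" "is_interval J"
    and fs: "\<And>s t. s \<in> I \<Longrightarrow> t \<in> J \<Longrightarrow> ((\<lambda>x. f x t) has_vector_derivative fs s t) (at s)"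
    and ft: "\<And>s t. s \<in> I \<Longrightarrow> t \<in> J \<Longrightarrow> ((\<lambda>y. f s y) has_vector_derivative ft s t) (at t)"
    and ds_dt: "\<And>s t. s \<in> I \<Longrightarrow> t \<in> J \<Longrightarrow> ((\<lambda>y. fs s y) has_vector_derivative h s t) (at t)"
    and cont: "continuous_on (I \<times> J) (\<lambda>(s, t). h s t)"
    and s: "s \<in> I" and t: "t \<in> J"
  shows "((\<lambda>x. ft x t) has_vector_derivative h s t) (at s)"
proof -
  obtain e where e: "e > 0" "cball s e \<subseteq> I"
    using I(1) s open_contains_cball by blast
  \<comment> \<open>The left end \<open>a\<close> is the base point of the integral;
    \<open>s\<close> is interior to the interval, so a derivative within it is a full derivative at
    \<open>s\<close>.\<close>
  define a b where "a = s - e" and "b = s + e"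
  have ab: "{a..b} \<subseteq> I" "a < s" "s < b"
    using e by (auto simp: a_def b_def cball_eq_atLeastAtMost)
  have ftc: "((\<lambda>u. fs u y) has_integral (f x y - f a y)) {a..x}" if "x \<in> {a..b}" "y \<in> J" for x y
    by (rule fundamental_theorem_of_calculus)
      (use that ab in \<open>auto intro!: has_vector_derivative_at_within[OF fs]\<close>)
  have aI: "a \<in> I"
    using ab by auto
  have ft_eq: "ft x t = ft a t + integral {a..x} (\<lambda>u. h u t)" if x: "x \<in> {a..b}" for x
  proof -
    have "((\<lambda>y. integral (cbox a x) (\<lambda>u. fs u y)) has_vector_derivative
        integral (cbox a x) (\<lambda>u. h u t)) (at t within J)"
    proof (rule leibniz_rule_vector_derivative[where fx = "\<lambda>y u. h u y"])
      show "((\<lambda>y. fs u y) has_vector_derivative h u y) (at y within J)"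
        if "y \<in> J" "u \<in> cbox a x" for y u
        using that x ab by (auto intro!: has_vector_derivative_at_within[OF ds_dt])
      show "(\<lambda>u. fs u y) integrable_on cbox a x" if "y \<in> J" for y
        using ftc[OF x that] by (auto simp: integrable_on_def)
      \<comment> \<open>The Leibniz rule puts the parameter first, so \<open>cont\<close> is applied
        after swapping the coordinates.\<close>
      show "continuous_on (J \<times> cbox a x) (\<lambda>(y, u). h u y)"
      proof -
        have "continuous_on (J \<times> cbox a x) (\<lambda>p. (snd p, fst p))"
          by (intro continuous_intros)
        moreover have "(\<lambda>p. (snd p, fst p)) ` (J \<times> cbox a x) \<subseteq> I \<times> J"
          using x ab by auto
        ultimately have "continuous_on (J \<times> cbox a x)
            (\<lambda>p. case (snd p, fst p) of (u, y) \<Rightarrow> h u y)"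
          by (rule continuous_on_compose2[OF cont])
        then show ?thesis
          by (simp add: split_beta)
      qed
    qed (use t J in \<open>auto simp: is_interval_convex\<close>)
    then have "((\<lambda>y. f a y + integral {a..x} (\<lambda>u. fs u y)) has_vector_derivative
        ft a t + integral {a..x} (\<lambda>u. h u t)) (at t)"
      using ft[OF aI t] at_within_open[OF t J(1)] by (simp add: has_vector_derivative_add)
    moreover have "f a y + integral {a..x} (\<lambda>u. fs u y) = f x y" if "y \<in> J" for y
      using integral_unique[OF ftc[OF x that]] by simp
    ultimately have "((\<lambda>y. f x y) has_vector_derivative
        ft a t + integral {a..x} (\<lambda>u. h u t)) (at t)"
      by (rule has_vector_derivative_transform_within_open[OF _ J(1) t])
    moreover have "x \<in> I" using x ab by auto
    ultimately show ?thesis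
      using ft t vector_derivative_unique_at by blast
  qed
  have "continuous_on {a..b} (\<lambda>u. case (u, t) of (s, t) \<Rightarrow> h s t)"
    by (rule continuous_on_compose2[OF cont]) (use ab t in \<open>auto intro!: continuous_intros\<close>)
  then have "continuous_on {a..b} (\<lambda>u. h u t)"
    by simp
  then have "((\<lambda>x. ft a t + integral {a..x} (\<lambda>u. h u t)) has_vector_derivative h s t)
      (at s within {a..b})"
    using ab by (auto intro!: derivative_eq_intros integral_has_vector_derivative)
  then have "((\<lambda>x. ft a t + integral {a..x} (\<lambda>u. h u t)) has_vector_derivative h s t) (at s)"
    using ab at_within_Icc_at[of a s b] by simp
  then show ?thesis
  proof (rule has_vector_derivative_transform_within_open[where S = "{a<..<b}"])
    show "ft a t + integral {a..x} (\<lambda>u. h u t) = ft x t" if "x \<in> {a<..<b}" for x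
      using that by (intro ft_eq[symmetric]) auto
  qed (use ab in auto)
qed

text \<open>The preceding lemma with \<open>h\<close> taken to be \<open>dt (ds f)\<close>, which is
  continuous because \<open>ds\<close> and \<open>dt\<close> preserve smoothness.\<close>

lemma smooth_on_ds_dt_commute:
  fixes f :: "real \<Rightarrow> real \<Rightarrow> 'a::banach"
  assumes I: "open I" "is_interval I" and J: "open J" "is_interval J"
    and f: "smooth_on (\<lambda>(s, t). f s t) (I \<times> J)" and "s \<in> I" "t \<in> J"
  shows "ds (dt f) s t = dt (ds f) s t"
proof -
  note fs = smooth_on_ds[OF I(1) J(1) f]
  note cont = smooth_on_imp_continuous_on[OF smooth_on_dt[OF I(1) J(1) fs]]
  have "((\<lambda>x. dt f x t) has_vector_derivative dt (ds f) s t) (at s)"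
  proof (rule mixed_partial_derivative[where f = f and fs = "ds f", OF I J _ _ _ cont assms(6,7)])
    fix s t assume st: "s \<in> I" "t \<in> J"
    show "((\<lambda>x. f x t) has_vector_derivative ds f s t) (at s)"
      by (rule smooth_on_has_ds[OF f st])
    show "((\<lambda>y. f s y) has_vector_derivative dt f s t) (at t)"
      by (rule smooth_on_has_dt[OF f st])
    show "((\<lambda>y. ds f s y) has_vector_derivative dt (ds f) s t) (at t)"
      by (rule smooth_on_has_dt[OF fs st])
  qed
  then show ?thesis
    by (rule ds_eqI)
qed

lemmas has_vector_derivative_inner =
  bounded_bilinear.has_vector_derivative[OF bounded_bilinear_inner]

text \<open>The product rule for a function that is constant near \<open>x\<close>. It is the source
  of the skew-symmetry below, in \<open>s\<close> as well as in \<open>t\<close>.\<close>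

lemma inner_const_has_vector_derivative:
  fixes u v :: "real \<Rightarrow> 'a::real_inner"
  assumes u: "(u has_vector_derivative u') (at x)" and v: "(v has_vector_derivative v') (at x)"
    and "open S" "x \<in> S" and c: "\<And>y. y \<in> S \<Longrightarrow> u y \<bullet> v y = c"
  shows "u' \<bullet> v x = - (u x \<bullet> v')"
proof -
  have "((\<lambda>y. c) has_vector_derivative u x \<bullet> v' + u' \<bullet> v x) (at x)"
    by (rule has_vector_derivative_transform_within_open[OF has_vector_derivative_inner[OF u v]])
      (use assms in auto)
  then have "u x \<bullet> v' + u' \<bullet> v x = 0"
    using vector_derivative_unique_at has_vector_derivative_const by blast
  then show ?thesis by simp
qed

section \<open>Orthonormal frames in dimension four\<close>

lemma vector_4 [simp]:
  "(vector [w, x, y, z] :: 'a::zero^4) $ 1 = w"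
  "(vector [w, x, y, z] :: 'a::zero^4) $ 2 = x"
  "(vector [w, x, y, z] :: 'a::zero^4) $ 3 = y"
  "(vector [w, x, y, z] :: 'a::zero^4) $ 4 = z"
  unfolding vector_def by simp_all

text \<open>Expansion along the first row, obtained by splitting off one index at a time from the
  permutations of four indices.\<close>

lemma det_4:
  "det (A :: 'a::comm_ring_1^4^4) =
     A$1$1 * (A$2$2 * (A$3$3 * A$4$4 - A$3$4 * A$4$3) - A$2$3 * (A$3$2 * A$4$4 - A$3$4 * A$4$2)
       + A$2$4 * (A$3$2 * A$4$3 - A$3$3 * A$4$2))
   - A$1$2 * (A$2$1 * (A$3$3 * A$4$4 - A$3$4 * A$4$3) - A$2$3 * (A$3$1 * A$4$4 - A$3$4 * A$4$1)
       + A$2$4 * (A$3$1 * A$4$3 - A$3$3 * A$4$1))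
   + A$1$3 * (A$2$1 * (A$3$2 * A$4$4 - A$3$4 * A$4$2) - A$2$2 * (A$3$1 * A$4$4 - A$3$4 * A$4$1)
       + A$2$4 * (A$3$1 * A$4$2 - A$3$2 * A$4$1))
   - A$1$4 * (A$2$1 * (A$3$2 * A$4$3 - A$3$3 * A$4$2) - A$2$2 * (A$3$1 * A$4$3 - A$3$3 * A$4$1)
       + A$2$3 * (A$3$1 * A$4$2 - A$3$2 * A$4$1))"
proof -
  have f1: "finite {2::4, 3, 4}" "1 \<notin> {2::4, 3, 4}"
    and f2: "finite {3::4, 4}" "2 \<notin> {3::4, 4}"
    and f3: "finite {4::4}" "3 \<notin> {4::4}"
    by auto
  show ?thesis
    unfolding det_def UNIV_4
    unfolding sum_over_permutations_insert[OF f1]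
    unfolding sum_over_permutations_insert[OF f2]
    unfolding sum_over_permutations_insert[OF f3]
    unfolding permutes_sing
    by (simp add: sign_swap_id permutation_swap_id permutation_compose sign_compose sign_id swap_id_eq algebra_simps)
qed

text \<open>Turns Gram conditions and coordinates with respect to a frame into matrix
  products.\<close>

lemma matrix_mult_transpose_nth:
  fixes A :: "real^'n^'m" and B :: "real^'n^'p"
  shows "(A ** transpose B) $ i $ j = A $ i \<bullet> B $ j"
  by (simp add: matrix_matrix_mult_def transpose_def inner_vec_def)

lemma pos_orthonormal_inner:
  assumes "pos_orthonormal u v w x"
  shows "u \<bullet> u = 1" "v \<bullet> v = 1" "w \<bullet> w = 1" "x \<bullet> x = 1"
    "u \<bullet> v = 0" "u \<bullet> w = 0" "u \<bullet> x = 0" "v \<bullet> w = 0" "v \<bullet> x = 0" "w \<bullet> x = 0"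
    "v \<bullet> u = 0" "w \<bullet> u = 0" "x \<bullet> u = 0" "w \<bullet> v = 0" "x \<bullet> v = 0" "x \<bullet> w = 0"
  using assms unfolding pos_orthonormal_def Let_def forall_4 by simp_all

text \<open>The Gram matrix is the identity, a one-sided inverse of a square matrix is two-sided,
  and positive orientation excludes determinant \<open>- 1\<close>.\<close>

lemma pos_orthonormal_matrix:
  assumes "pos_orthonormal u v w x"
  defines "F \<equiv> vector [u, v, w, x] :: real^4^4"
  shows "F ** transpose F = mat 1" "transpose F ** F = mat 1" "det F = 1"
proof -
  show FFt: "F ** transpose F = mat 1"
    using assms unfolding pos_orthonormal_def Let_def
    by (simp add: matrix_mult_transpose_nth mat_def vec_eq_iff)
  then show "transpose F ** F = mat 1"
    by (simp add: matrix_left_right_inverse)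
  then have "det F = 1 \<or> det F = - 1"
    by (intro det_orthogonal_matrix) (simp add: orthogonal_matrix)
  then show "det F = 1"
    using assms unfolding pos_orthonormal_def Let_def by auto
qed

text \<open>With the frame as matrix \<open>F\<close>, the hypothesis says
  \<open>A = X ** transpose F\<close>; multiply by \<open>F\<close> on the right.\<close>

lemma frame_expansion:
  assumes "pos_orthonormal u v w x"
    and "\<And>i j. X $ i \<bullet> (vector [u, v, w, x] :: real^4^4) $ j = A $ i $ j"
  shows "X = A ** (vector [u, v, w, x] :: real^4^4)"
proof -
  let ?F = "vector [u, v, w, x] :: real^4^4"
  have "A = X ** transpose ?F"
    using assms(2) by (simp add: matrix_mult_transpose_nth vec_eq_iff)
  then show ?thesis
    using pos_orthonormal_matrix(2)[OF assms(1)] by (simp flip: matrix_mul_assoc)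
qed

text \<open>The determinant is linear in its first row, so pairing with \<open>w\<close> replaces
  the symbolic row by \<open>w\<close> itself.\<close>

lemma inner_ternary_cross: "w \<bullet> ternary_cross x y z = det (vector [w, x, y, z] :: real^4^4)"
  by (simp add: ternary_cross_def inner_vec_def sum_4 det_4 axis_def algebra_simps)

text \<open>The signs come from the symbols \<open>e\<^sub>i\<close> standing in the first row of the formal determinant:
  for a positively oriented orthonormal frame, \<open>u \<times> v \<times> w = - x\<close>.\<close>

lemma ternary_cross_frame:
  assumes F: "pos_orthonormal u v w x"
  shows "u \<bullet> ternary_cross u y z = 0"
    "v \<bullet> ternary_cross u y z = (x \<bullet> y) * (w \<bullet> z) - (w \<bullet> y) * (x \<bullet> z)"
    "w \<bullet> ternary_cross u y z = (v \<bullet> y) * (x \<bullet> z) - (x \<bullet> y) * (v \<bullet> z)"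
    "x \<bullet> ternary_cross u y z = (w \<bullet> y) * (v \<bullet> z) - (v \<bullet> y) * (w \<bullet> z)"
proof -
  let ?F = "vector [u, v, w, x] :: real^4^4"
  \<comment> \<open>Multiplying by \<open>transpose ?F\<close> keeps the determinant and replaces
    each row by its frame coordinates. The row of \<open>u\<close>, and that of \<open>p\<close>
    when \<open>p\<close> is a frame vector, become standard basis vectors.\<close>
  have "det X = det (X ** transpose ?F)" for X
    using pos_orthonormal_matrix(3)[OF F] by (simp add: det_mul)
  then have "p \<bullet> ternary_cross u y z = det (vector [p, u, y, z] ** transpose ?F)" for p
    by (simp add: inner_ternary_cross)
  then show "u \<bullet> ternary_cross u y z = 0"
    "v \<bullet> ternary_cross u y z = (x \<bullet> y) * (w \<bullet> z) - (w \<bullet> y) * (x \<bullet> z)"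
    "w \<bullet> ternary_cross u y z = (v \<bullet> y) * (x \<bullet> z) - (x \<bullet> y) * (v \<bullet> z)"
    "x \<bullet> ternary_cross u y z = (w \<bullet> y) * (v \<bullet> z) - (v \<bullet> y) * (w \<bullet> z)"
    by (simp_all add: matrix_mult_transpose_nth det_4
        pos_orthonormal_inner[OF F] inner_commute)
qed

theorem theorem1:
  fixes I J :: "real set"
    and \<Psi> T P\<^sub>1 P\<^sub>2 P\<^sub>3 :: "real \<Rightarrow> real \<Rightarrow> real^4"
    and k\<^sub>1 k\<^sub>2 k\<^sub>3 :: "real \<Rightarrow> real \<Rightarrow> real"
  assumes I: "open I" "is_interval I" "I \<noteq> {}"
    and J: "open J" "is_interval J" "J \<noteq> {}"
    and smooth: "smooth_on (\<lambda>(s, t). \<Psi> s t) (I \<times> J)"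
    and bdr: "betchov_da_rios I J \<Psi>"
    and unit_speed: "\<And>s t. s \<in> I \<Longrightarrow> t \<in> J \<Longrightarrow> norm (ds \<Psi> s t) = 1"
    and frame: "parallel_transport_frame I J \<Psi> T P\<^sub>1 P\<^sub>2 P\<^sub>3"
    and k1: "\<And>s t. s \<in> I \<Longrightarrow> t \<in> J \<Longrightarrow> k\<^sub>1 s t = ds T s t \<bullet> P\<^sub>1 s t"
    and k2: "\<And>s t. s \<in> I \<Longrightarrow> t \<in> J \<Longrightarrow> k\<^sub>2 s t = ds T s t \<bullet> P\<^sub>2 s t"
    and k3: "\<And>s t. s \<in> I \<Longrightarrow> t \<in> J \<Longrightarrow> k\<^sub>3 s t = ds T s t \<bullet> P\<^sub>3 s t"
    and two_nonzero:
      "(\<exists>s\<in>I. \<exists>t\<in>J. k\<^sub>1 s t \<noteq> 0) \<and> (\<exists>s\<in>I. \<exists>t\<in>J. k\<^sub>2 s t \<noteq> 0) \<or>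
       (\<exists>s\<in>I. \<exists>t\<in>J. k\<^sub>1 s t \<noteq> 0) \<and> (\<exists>s\<in>I. \<exists>t\<in>J. k\<^sub>3 s t \<noteq> 0) \<or>
       (\<exists>s\<in>I. \<exists>t\<in>J. k\<^sub>2 s t \<noteq> 0) \<and> (\<exists>s\<in>I. \<exists>t\<in>J. k\<^sub>3 s t \<noteq> 0)"
    and PRS: "\<And>s t. s \<in> I \<Longrightarrow> t \<in> J \<Longrightarrow>
      \<not> (k\<^sub>3 s t * ds k\<^sub>2 s t - k\<^sub>2 s t * ds k\<^sub>3 s t = 0 \<and>
         k\<^sub>1 s t * ds k\<^sub>3 s t - k\<^sub>3 s t * ds k\<^sub>1 s t = 0 \<and>
         k\<^sub>2 s t * ds k\<^sub>1 s t - k\<^sub>1 s t * ds k\<^sub>2 s t = 0)"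
  shows
    "(\<forall>s\<in>I. \<forall>t\<in>J.
        (vector [ds T s t, ds P\<^sub>1 s t, ds P\<^sub>2 s t, ds P\<^sub>3 s t] :: real^4^4) =
        (vector [vector [0, k\<^sub>1 s t, k\<^sub>2 s t, k\<^sub>3 s t],
                 vector [- k\<^sub>1 s t, 0, 0, 0],
                 vector [- k\<^sub>2 s t, 0, 0, 0],
                 vector [- k\<^sub>3 s t, 0, 0, 0]] :: real^4^4)
        ** (vector [T s t, P\<^sub>1 s t, P\<^sub>2 s t, P\<^sub>3 s t] :: real^4^4)) \<and>
     (\<exists>a\<^sub>1\<^sub>2 a\<^sub>1\<^sub>3 a\<^sub>1\<^sub>4 a\<^sub>2\<^sub>3 a\<^sub>2\<^sub>4 a\<^sub>3\<^sub>4 :: real \<Rightarrow> real \<Rightarrow> real. \<forall>s\<in>I. \<forall>t\<in>J.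
        (vector [dt T s t, dt P\<^sub>1 s t, dt P\<^sub>2 s t, dt P\<^sub>3 s t] :: real^4^4) =
        (vector [vector [0, a\<^sub>1\<^sub>2 s t, a\<^sub>1\<^sub>3 s t, a\<^sub>1\<^sub>4 s t],
                 vector [- a\<^sub>1\<^sub>2 s t, 0, a\<^sub>2\<^sub>3 s t, a\<^sub>2\<^sub>4 s t],
                 vector [- a\<^sub>1\<^sub>3 s t, - a\<^sub>2\<^sub>3 s t, 0, a\<^sub>3\<^sub>4 s t],
                 vector [- a\<^sub>1\<^sub>4 s t, - a\<^sub>2\<^sub>4 s t, - a\<^sub>3\<^sub>4 s t, 0]] :: real^4^4)
        ** (vector [T s t, P\<^sub>1 s t, P\<^sub>2 s t, P\<^sub>3 s t] :: real^4^4) \<and>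
        a\<^sub>1\<^sub>2 s t = k\<^sub>3 s t * ds (ds k\<^sub>2) s t - k\<^sub>2 s t * ds (ds k\<^sub>3) s t \<and>
        a\<^sub>1\<^sub>3 s t = k\<^sub>1 s t * ds (ds k\<^sub>3) s t - k\<^sub>3 s t * ds (ds k\<^sub>1) s t \<and>
        a\<^sub>1\<^sub>4 s t = k\<^sub>2 s t * ds (ds k\<^sub>1) s t - k\<^sub>1 s t * ds (ds k\<^sub>2) s t \<and>
        ((\<lambda>x. a\<^sub>2\<^sub>3 x t) has_real_derivative
          k\<^sub>3 s t * (k\<^sub>1 s t * ds (ds k\<^sub>1) s t + k\<^sub>2 s t * ds (ds k\<^sub>2) s t)
          - ds (ds k\<^sub>3) s t * ((k\<^sub>1 s t)\<^sup>2 + (k\<^sub>2 s t)\<^sup>2)) (at s) \<and>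
        ((\<lambda>x. a\<^sub>2\<^sub>4 x t) has_real_derivative
          - k\<^sub>2 s t * (k\<^sub>1 s t * ds (ds k\<^sub>1) s t + k\<^sub>3 s t * ds (ds k\<^sub>3) s t)
          + ds (ds k\<^sub>2) s t * ((k\<^sub>1 s t)\<^sup>2 + (k\<^sub>3 s t)\<^sup>2)) (at s) \<and>
        ((\<lambda>x. a\<^sub>3\<^sub>4 x t) has_real_derivative
          k\<^sub>1 s t * (k\<^sub>2 s t * ds (ds k\<^sub>2) s t + k\<^sub>3 s t * ds (ds k\<^sub>3) s t)
          - ds (ds k\<^sub>1) s t * ((k\<^sub>2 s t)\<^sup>2 + (k\<^sub>3 s t)\<^sup>2)) (at s))"
proof -

  \<comment> \<open>The frame and its derivatives in \<open>s\<close>\<close>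
  have smT: "smooth_on (\<lambda>(s, t). T s t) (I \<times> J)"
    using frame unfolding parallel_transport_frame_def by auto
  have sm: "smooth_on (\<lambda>(s, t). P s t) (I \<times> J)" if "P \<in> {P\<^sub>1, P\<^sub>2, P\<^sub>3}" for P
    using frame that unfolding parallel_transport_frame_def by auto
  have F: "pos_orthonormal (T s t) (P\<^sub>1 s t) (P\<^sub>2 s t) (P\<^sub>3 s t)"
    and T: "T s t = ds \<Psi> s t"
    and par: "\<And>P. P \<in> {P\<^sub>1, P\<^sub>2, P\<^sub>3} \<Longrightarrow> \<exists>c. ds P s t = c *\<^sub>R T s t"
    if "s \<in> I" "t \<in> J" for s t
    using frame that unfolding parallel_transport_frame_def by blast+
  note on = pos_orthonormal_inner[OF F]
  note ds_smooth = smooth_on_ds[OF I(1) J(1)] and has_ds = smooth_on_has_ds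
    and has_dt = smooth_on_has_dt
  note commute = smooth_on_ds_dt_commute[OF I(1,2) J(1,2)]

  \<comment> \<open>Differentiating the orthogonality of \<open>T\<close> and \<open>P\<close> in
    \<open>s\<close> determines the unspecified multiple: it is \<open>- k s t\<close>.\<close>
  have dsP_gen: "ds P s t = - k s t *\<^sub>R T s t"
    if st: "s \<in> I" "t \<in> J" and P: "P \<in> {P\<^sub>1, P\<^sub>2, P\<^sub>3}" and k: "k s t = ds T s t \<bullet> P s t" for P k s t
  proof -
    obtain c where c: "ds P s t = c *\<^sub>R T s t" using par[OF st P] by blast
    have "ds T s t \<bullet> P s t = - (T s t \<bullet> ds P s t)"
      by (rule inner_const_has_vector_derivative[where S = I and c = 0,
            OF has_ds[OF smT st] has_ds[OF sm[OF P] st] I(1) st(1)])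
        (use P on st(2) in auto)
    then show ?thesis using c k on(1)[OF st] by simp
  qed
  have dsP: "ds P\<^sub>1 s t = - k\<^sub>1 s t *\<^sub>R T s t" "ds P\<^sub>2 s t = - k\<^sub>2 s t *\<^sub>R T s t"
    "ds P\<^sub>3 s t = - k\<^sub>3 s t *\<^sub>R T s t" if "s \<in> I" "t \<in> J" for s t
    using dsP_gen[of s t P\<^sub>1 k\<^sub>1, OF that _ k1[OF that]] dsP_gen[of s t P\<^sub>2 k\<^sub>2, OF that _ k2[OF that]]
      dsP_gen[of s t P\<^sub>3 k\<^sub>3, OF that _ k3[OF that]] by simp_all
  have dsT_T: "ds T s t \<bullet> T s t = 0" if st: "s \<in> I" "t \<in> J" for s t
    using inner_const_has_vector_derivative[where S = I and c = 1,
        OF has_ds[OF smT st] has_ds[OF smT st] I(1) st(1)] on(1) st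
    by (simp add: inner_commute)

  \<comment> \<open>Derivatives of the curvature functions in \<open>s\<close>\<close>
  have k_has_ds: "((\<lambda>x. k x t) has_vector_derivative ds (ds T) s t \<bullet> P s t) (at s)"
    if st: "s \<in> I" "t \<in> J" and P: "P \<in> {P\<^sub>1, P\<^sub>2, P\<^sub>3}"
      and k: "\<And>x. x \<in> I \<Longrightarrow> k x t = ds T x t \<bullet> P x t" for P k s t
  proof -
    have "((\<lambda>x. ds T x t \<bullet> P x t) has_vector_derivative
        ds T s t \<bullet> ds P s t + ds (ds T) s t \<bullet> P s t) (at s)"
      by (rule has_vector_derivative_inner[OF has_ds[OF ds_smooth[OF smT] st] has_ds[OF sm[OF P] st]])
    \<comment> \<open>\<open>ds P\<close> is parallel to \<open>T\<close>, while \<open>ds T\<close>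
      is orthogonal to it because \<open>T\<close> has constant length.\<close>
    moreover have "ds T s t \<bullet> ds P s t = 0"
      using par[OF st P] dsT_T[OF st] by auto
    ultimately show ?thesis
      using has_vector_derivative_transform_within_open[OF _ I(1) st(1),
          of "\<lambda>x. ds T x t \<bullet> P x t" _ "\<lambda>x. k x t"] k by simp
  qed
  \<comment> \<open>Differentiability of \<open>ds k\<close> comes from its expression through the
    frame; the value stays in the form \<open>ds (ds k)\<close>.\<close>
  have k_has_dss: "((\<lambda>x. ds k x t) has_vector_derivative ds (ds k) s t) (at s)"
    if st: "s \<in> I" "t \<in> J" and P: "P \<in> {P\<^sub>1, P\<^sub>2, P\<^sub>3}"
      and k: "\<And>x. x \<in> I \<Longrightarrow> k x t = ds T x t \<bullet> P x t" for P k s t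
  proof -
    have "((\<lambda>x. ds (ds T) x t \<bullet> P x t) has_vector_derivative
        ds (ds T) s t \<bullet> ds P s t + ds (ds (ds T)) s t \<bullet> P s t) (at s)"
      by (rule has_vector_derivative_inner[OF has_ds[OF ds_smooth[OF ds_smooth[OF smT]] st] has_ds[OF sm[OF P] st]])
    moreover have "ds (ds T) x t \<bullet> P x t = ds k x t" if "x \<in> I" for x
      using ds_eqI[of k, OF k_has_ds[of x t P k, OF that st(2) P k]] by simp
    ultimately have "((\<lambda>x. ds k x t) has_vector_derivative
        ds (ds T) s t \<bullet> ds P s t + ds (ds (ds T)) s t \<bullet> P s t) (at s)"
      by (rule has_vector_derivative_transform_within_open[OF _ I(1) st(1)])
    then show ?thesis using ds_eqI[of "ds k"] by simp
  qed
  have dsk: "((\<lambda>x. k\<^sub>1 x t) has_vector_derivative ds k\<^sub>1 s t) (at s)"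
    "((\<lambda>x. k\<^sub>2 x t) has_vector_derivative ds k\<^sub>2 s t) (at s)"
    "((\<lambda>x. k\<^sub>3 x t) has_vector_derivative ds k\<^sub>3 s t) (at s)"
    "((\<lambda>x. ds k\<^sub>1 x t) has_vector_derivative ds (ds k\<^sub>1) s t) (at s)"
    "((\<lambda>x. ds k\<^sub>2 x t) has_vector_derivative ds (ds k\<^sub>2) s t) (at s)"
    "((\<lambda>x. ds k\<^sub>3 x t) has_vector_derivative ds (ds k\<^sub>3) s t) (at s)"
    and dsk_eq: "ds k\<^sub>1 s t = ds (ds T) s t \<bullet> P\<^sub>1 s t" "ds k\<^sub>2 s t = ds (ds T) s t \<bullet> P\<^sub>2 s t"
    "ds k\<^sub>3 s t = ds (ds T) s t \<bullet> P\<^sub>3 s t"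
    if st: "s \<in> I" "t \<in> J" for s t
  proof -
    note hk = k_has_ds[of s t P\<^sub>1 k\<^sub>1, OF st _ k1[OF _ st(2)]]
      k_has_ds[of s t P\<^sub>2 k\<^sub>2, OF st _ k2[OF _ st(2)]]
      k_has_ds[of s t P\<^sub>3 k\<^sub>3, OF st _ k3[OF _ st(2)]]
    show eqs: "ds k\<^sub>1 s t = ds (ds T) s t \<bullet> P\<^sub>1 s t" "ds k\<^sub>2 s t = ds (ds T) s t \<bullet> P\<^sub>2 s t"
      "ds k\<^sub>3 s t = ds (ds T) s t \<bullet> P\<^sub>3 s t"
      using ds_eqI[of k\<^sub>1, OF hk(1)] ds_eqI[of k\<^sub>2, OF hk(2)] ds_eqI[of k\<^sub>3, OF hk(3)] by simp_all
    show "((\<lambda>x. k\<^sub>1 x t) has_vector_derivative ds k\<^sub>1 s t) (at s)"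
      "((\<lambda>x. k\<^sub>2 x t) has_vector_derivative ds k\<^sub>2 s t) (at s)"
      "((\<lambda>x. k\<^sub>3 x t) has_vector_derivative ds k\<^sub>3 s t) (at s)"
      unfolding eqs using hk by simp_all
    show "((\<lambda>x. ds k\<^sub>1 x t) has_vector_derivative ds (ds k\<^sub>1) s t) (at s)"
      "((\<lambda>x. ds k\<^sub>2 x t) has_vector_derivative ds (ds k\<^sub>2) s t) (at s)"
      "((\<lambda>x. ds k\<^sub>3 x t) has_vector_derivative ds (ds k\<^sub>3) s t) (at s)"
      using k_has_dss[of s t P\<^sub>1 k\<^sub>1, OF st _ k1[OF _ st(2)]]
        k_has_dss[of s t P\<^sub>2 k\<^sub>2, OF st _ k2[OF _ st(2)]]
        k_has_dss[of s t P\<^sub>3 k\<^sub>3, OF st _ k3[OF _ st(2)]] by simp_all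
  qed

  \<comment> \<open>Frame components of the velocity \<open>dt \<Psi>\<close>\<close>
  have ds_cong: "ds f s t = ds g s t"
    if "s \<in> I" "t \<in> J" "\<And>x. x \<in> I \<Longrightarrow> f x t = g x t" "smooth_on (\<lambda>(s, t). g s t) (I \<times> J)"
    for f g :: "real \<Rightarrow> real \<Rightarrow> real^4" and s t
    by (rule ds_eqI[of f],
        rule has_vector_derivative_transform_within_open[OF has_ds[OF that(4,1,2)] I(1) that(1)])
      (use that in auto)
  note smT' = ds_smooth[OF smooth]
  have ds\<Psi>: "ds (ds \<Psi>) s t = ds T s t" if "s \<in> I" "t \<in> J" for s t
    by (rule ds_cong[OF that _ smT, of "ds \<Psi>"]) (use that T in auto)
  have dss\<Psi>: "ds (ds (ds \<Psi>)) s t = ds (ds T) s t" if "s \<in> I" "t \<in> J" for s t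
    by (rule ds_cong[OF that _ ds_smooth[OF smT], of "ds (ds \<Psi>)"]) (use that ds\<Psi> in auto)
  have dt\<Psi>: "dt \<Psi> s t = ternary_cross (T s t) (ds T s t) (ds (ds T) s t)"
    if "s \<in> I" "t \<in> J" for s t
    using bdr that unfolding betchov_da_rios_def by (simp add: ds\<Psi> dss\<Psi> T)
  \<comment> \<open>The arguments \<open>ds T\<close> and \<open>ds (ds T)\<close> of the ternary
    product have components \<open>k\<^sub>i\<close> and \<open>ds k\<^sub>i\<close> along
    \<open>P\<^sub>i\<close>, so \<open>ternary_cross_frame\<close> yields their two-by-two
    minors.\<close>
  have dt\<Psi>_frame: "T s t \<bullet> dt \<Psi> s t = 0"
    "P\<^sub>1 s t \<bullet> dt \<Psi> s t = k\<^sub>3 s t * ds k\<^sub>2 s t - k\<^sub>2 s t * ds k\<^sub>3 s t"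
    "P\<^sub>2 s t \<bullet> dt \<Psi> s t = k\<^sub>1 s t * ds k\<^sub>3 s t - k\<^sub>3 s t * ds k\<^sub>1 s t"
    "P\<^sub>3 s t \<bullet> dt \<Psi> s t = k\<^sub>2 s t * ds k\<^sub>1 s t - k\<^sub>1 s t * ds k\<^sub>2 s t"
    if st: "s \<in> I" "t \<in> J" for s t
    using ternary_cross_frame[OF F[OF st], of "ds T s t" "ds (ds T) s t"]
    by (simp_all add: dt\<Psi> st k1 k2 k3 dsk_eq inner_commute)

  \<comment> \<open>Frame components of \<open>dt T\<close>\<close>
  have ds_dt\<Psi>: "ds (dt \<Psi>) s t = dt T s t" if st: "s \<in> I" "t \<in> J" for s t
  proof -
    have "((\<lambda>y. T s y) has_vector_derivative dt (ds \<Psi>) s t) (at t)"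
      by (rule has_vector_derivative_transform_within_open[OF has_dt[OF smT' st] J(1) st(2)])
        (use st T in auto)
    then show ?thesis
      using commute[OF smooth st] dt_eqI[of T] by simp
  qed
  have dtT_gen: "dt T s t \<bullet> P s t = d"
    if st: "s \<in> I" "t \<in> J" and P: "P \<in> {P\<^sub>1, P\<^sub>2, P\<^sub>3}"
      and g: "\<And>x. x \<in> I \<Longrightarrow> g x = P x t \<bullet> dt \<Psi> x t"
      and d: "(g has_vector_derivative d) (at s)" for P g d s t
  proof -
    have "((\<lambda>x. P x t \<bullet> dt \<Psi> x t) has_vector_derivative
        P s t \<bullet> dt T s t + ds P s t \<bullet> dt \<Psi> s t) (at s)"
      using has_vector_derivative_inner[OF has_ds[OF sm[OF P] st]
          has_ds[OF smooth_on_dt[OF I(1) J(1) smooth] st]]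
      by (simp add: ds_dt\<Psi>[OF st])
    moreover have "((\<lambda>x. P x t \<bullet> dt \<Psi> x t) has_vector_derivative d) (at s)"
      by (rule has_vector_derivative_transform_within_open[OF d I(1) st(1)]) (use g in auto)
    ultimately have "d = P s t \<bullet> dt T s t + ds P s t \<bullet> dt \<Psi> s t"
      using vector_derivative_unique_at by blast
    \<comment> \<open>\<open>ds P\<close> is a multiple of \<open>T\<close>, and the velocity has no
      component along \<open>T\<close>.\<close>
    moreover have "ds P s t \<bullet> dt \<Psi> s t = 0"
      using par[OF st P] dt\<Psi>_frame(1)[OF st] by auto
    ultimately show ?thesis by (simp add: inner_commute)
  qed
  \<comment> \<open>Each \<open>g\<close> is a component of the velocity. In its derivative the
    products of two first derivatives cancel, leaving only second derivatives.\<close>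
  have dtT: "dt T s t \<bullet> P\<^sub>1 s t = k\<^sub>3 s t * ds (ds k\<^sub>2) s t - k\<^sub>2 s t * ds (ds k\<^sub>3) s t"
    "dt T s t \<bullet> P\<^sub>2 s t = k\<^sub>1 s t * ds (ds k\<^sub>3) s t - k\<^sub>3 s t * ds (ds k\<^sub>1) s t"
    "dt T s t \<bullet> P\<^sub>3 s t = k\<^sub>2 s t * ds (ds k\<^sub>1) s t - k\<^sub>1 s t * ds (ds k\<^sub>2) s t"
    if st: "s \<in> I" "t \<in> J" for s t
  proof -
    show "dt T s t \<bullet> P\<^sub>1 s t = k\<^sub>3 s t * ds (ds k\<^sub>2) s t - k\<^sub>2 s t * ds (ds k\<^sub>3) s t"
      by (rule dtT_gen[OF st, where g = "\<lambda>x. k\<^sub>3 x t * ds k\<^sub>2 x t - k\<^sub>2 x t * ds k\<^sub>3 x t"])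
        (use st in \<open>auto intro!: derivative_eq_intros dsk simp: dt\<Psi>_frame\<close>)
    show "dt T s t \<bullet> P\<^sub>2 s t = k\<^sub>1 s t * ds (ds k\<^sub>3) s t - k\<^sub>3 s t * ds (ds k\<^sub>1) s t"
      by (rule dtT_gen[OF st, where g = "\<lambda>x. k\<^sub>1 x t * ds k\<^sub>3 x t - k\<^sub>3 x t * ds k\<^sub>1 x t"])
        (use st in \<open>auto intro!: derivative_eq_intros dsk simp: dt\<Psi>_frame\<close>)
    show "dt T s t \<bullet> P\<^sub>3 s t = k\<^sub>2 s t * ds (ds k\<^sub>1) s t - k\<^sub>1 s t * ds (ds k\<^sub>2) s t"
      by (rule dtT_gen[OF st, where g = "\<lambda>x. k\<^sub>2 x t * ds k\<^sub>1 x t - k\<^sub>1 x t * ds k\<^sub>2 x t"])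
        (use st in \<open>auto intro!: derivative_eq_intros dsk simp: dt\<Psi>_frame\<close>)
  qed

  \<comment> \<open>Skew-symmetry in \<open>t\<close> and the \<open>s\<close>-derivatives of the
    normal components\<close>
  have skew: "dt V s t \<bullet> W s t = - (V s t \<bullet> dt W s t)"
    if st: "s \<in> I" "t \<in> J" and VW: "V \<in> {T, P\<^sub>1, P\<^sub>2, P\<^sub>3}" "W \<in> {T, P\<^sub>1, P\<^sub>2, P\<^sub>3}" for V W s t
  proof (rule inner_const_has_vector_derivative[OF has_dt[OF _ st] has_dt[OF _ st] J(1) st(2)])
    show "smooth_on (\<lambda>(s, t). V s t) (I \<times> J)" "smooth_on (\<lambda>(s, t). W s t) (I \<times> J)"
      using VW smT sm by auto
    show "V s y \<bullet> W s y = (if V = W then 1 else 0)" if "y \<in> J" for y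
      using VW on[OF st(1) that] by auto
  qed

  have ds_a: "((\<lambda>x. dt V x t \<bullet> W x t) has_vector_derivative
      k' s t * (dt T s t \<bullet> V s t) - k s t * (dt T s t \<bullet> W s t)) (at s)"
    if st: "s \<in> I" "t \<in> J" and VW: "V \<in> {P\<^sub>1, P\<^sub>2, P\<^sub>3}" "W \<in> {P\<^sub>1, P\<^sub>2, P\<^sub>3}"
      and k: "\<And>y. y \<in> J \<Longrightarrow> ds V s y = - k s y *\<^sub>R T s y" and k': "ds W s t = - k' s t *\<^sub>R T s t"
      and orth: "\<And>y. y \<in> J \<Longrightarrow> T s y \<bullet> W s y = 0" for V W k k' s t
  proof -
    have smV: "smooth_on (\<lambda>(s, t). V s t) (I \<times> J)" and smW: "smooth_on (\<lambda>(s, t). W s t) (I \<times> J)"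
      using VW sm by auto
    have "((\<lambda>x. dt V x t \<bullet> W x t) has_vector_derivative
        dt V s t \<bullet> ds W s t + ds (dt V) s t \<bullet> W s t) (at s)"
      by (rule has_vector_derivative_inner[OF has_ds[OF smooth_on_dt[OF I(1) J(1) smV] st]
            has_ds[OF smW st]])
    \<comment> \<open>After exchanging the partial derivatives, the relation that
      \<open>ds V\<close> is orthogonal to \<open>W\<close> is differentiated in \<open>t\<close>;
      thus no \<open>t\<close>-derivative of \<open>k\<close> appears.\<close>
    moreover have "ds (dt V) s t \<bullet> W s t = - (ds V s t \<bullet> dt W s t)"
      unfolding commute[OF smV st]
      by (rule inner_const_has_vector_derivative[where c = 0,
            OF has_dt[OF ds_smooth[OF smV] st] has_dt[OF smW st] J(1) st(2)])
        (simp add: k orth)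
    \<comment> \<open>Skew-symmetry shifts the \<open>t\<close>-derivative onto \<open>T\<close>,
      whose components are known from \<open>dtT\<close>.\<close>
    moreover have "T s t \<bullet> dt W s t = - (dt T s t \<bullet> W s t)" "T s t \<bullet> dt V s t = - (dt T s t \<bullet> V s t)"
      using skew[OF st, of T] VW by auto
    ultimately show ?thesis
      by (simp add: k[OF st(2)] k' inner_commute[of "dt V s t"])
  qed

  \<comment> \<open>The two matrix formulas and the antiderivatives\<close>
  have row_ds: "(vector [ds T s t, ds P\<^sub>1 s t, ds P\<^sub>2 s t, ds P\<^sub>3 s t] :: real^4^4) =
      (vector [vector [0, k\<^sub>1 s t, k\<^sub>2 s t, k\<^sub>3 s t],
               vector [- k\<^sub>1 s t, 0, 0, 0],
               vector [- k\<^sub>2 s t, 0, 0, 0],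
               vector [- k\<^sub>3 s t, 0, 0, 0]] :: real^4^4)
      ** (vector [T s t, P\<^sub>1 s t, P\<^sub>2 s t, P\<^sub>3 s t] :: real^4^4)"
    if st: "s \<in> I" "t \<in> J" for s t
    \<comment> \<open>Turning the meta-level quantifiers over indices into object-level ones lets
      \<open>forall_4\<close> split the goal into the sixteen entries.\<close>
    by (rule frame_expansion[OF F[OF st]], unfold atomize_all forall_4)
      (simp add: on[OF st] dsT_T[OF st] dsP[OF st] k1[OF st] k2[OF st] k3[OF st])
  have row_dt: "(vector [dt T s t, dt P\<^sub>1 s t, dt P\<^sub>2 s t, dt P\<^sub>3 s t] :: real^4^4) =
      (vector [vector [0, dt T s t \<bullet> P\<^sub>1 s t, dt T s t \<bullet> P\<^sub>2 s t, dt T s t \<bullet> P\<^sub>3 s t],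
               vector [- (dt T s t \<bullet> P\<^sub>1 s t), 0, dt P\<^sub>1 s t \<bullet> P\<^sub>2 s t, dt P\<^sub>1 s t \<bullet> P\<^sub>3 s t],
               vector [- (dt T s t \<bullet> P\<^sub>2 s t), - (dt P\<^sub>1 s t \<bullet> P\<^sub>2 s t), 0, dt P\<^sub>2 s t \<bullet> P\<^sub>3 s t],
               vector [- (dt T s t \<bullet> P\<^sub>3 s t), - (dt P\<^sub>1 s t \<bullet> P\<^sub>3 s t), - (dt P\<^sub>2 s t \<bullet> P\<^sub>3 s t), 0]]
        :: real^4^4)
      ** (vector [T s t, P\<^sub>1 s t, P\<^sub>2 s t, P\<^sub>3 s t] :: real^4^4)"
    if st: "s \<in> I" "t \<in> J" for s t
  proof -
    have neg: "dt W s t \<bullet> V s t = - (dt V s t \<bullet> W s t)"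
      if "V \<in> {T, P\<^sub>1, P\<^sub>2, P\<^sub>3}" "W \<in> {T, P\<^sub>1, P\<^sub>2, P\<^sub>3}" for V W
      using skew[OF st that] by (simp add: inner_commute)
    have zero: "dt V s t \<bullet> V s t = 0" if "V \<in> {T, P\<^sub>1, P\<^sub>2, P\<^sub>3}" for V
      using neg[OF that that] by simp
    show ?thesis
      \<comment> \<open>The chosen instances of \<open>neg\<close> rewrite entries below the
        diagonal to those above it.\<close>
      by (rule frame_expansion[OF F[OF st]], unfold atomize_all forall_4)
        (simp add: zero neg[of T P\<^sub>1] neg[of T P\<^sub>2] neg[of T P\<^sub>3]
          neg[of P\<^sub>1 P\<^sub>2] neg[of P\<^sub>1 P\<^sub>3] neg[of P\<^sub>2 P\<^sub>3])
  qed
  have a_ds: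
    "((\<lambda>x. dt P\<^sub>1 x t \<bullet> P\<^sub>2 x t) has_real_derivative
        k\<^sub>3 s t * (k\<^sub>1 s t * ds (ds k\<^sub>1) s t + k\<^sub>2 s t * ds (ds k\<^sub>2) s t)
        - ds (ds k\<^sub>3) s t * ((k\<^sub>1 s t)\<^sup>2 + (k\<^sub>2 s t)\<^sup>2)) (at s)"
    "((\<lambda>x. dt P\<^sub>1 x t \<bullet> P\<^sub>3 x t) has_real_derivative
        - k\<^sub>2 s t * (k\<^sub>1 s t * ds (ds k\<^sub>1) s t + k\<^sub>3 s t * ds (ds k\<^sub>3) s t)
        + ds (ds k\<^sub>2) s t * ((k\<^sub>1 s t)\<^sup>2 + (k\<^sub>3 s t)\<^sup>2)) (at s)"
    "((\<lambda>x. dt P\<^sub>2 x t \<bullet> P\<^sub>3 x t) has_real_derivative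
        k\<^sub>1 s t * (k\<^sub>2 s t * ds (ds k\<^sub>2) s t + k\<^sub>3 s t * ds (ds k\<^sub>3) s t)
        - ds (ds k\<^sub>1) s t * ((k\<^sub>2 s t)\<^sup>2 + (k\<^sub>3 s t)\<^sup>2)) (at s)"
    if st: "s \<in> I" "t \<in> J" for s t
    \<comment> \<open>With \<open>a\<^sub>1\<^sub>2\<close>, \<open>a\<^sub>1\<^sub>3\<close> the
      first two components in \<open>dtT\<close>, the first derivative is \<open>k\<^sub>2 *
      a\<^sub>1\<^sub>2 - k\<^sub>1 * a\<^sub>1\<^sub>3\<close>; expanding gives the stated
      integrand, and likewise for the other two.\<close>
    using ds_a[OF st, of P\<^sub>1 P\<^sub>2 k\<^sub>1 k\<^sub>2] ds_a[OF st, of P\<^sub>1 P\<^sub>3 k\<^sub>1 k\<^sub>3] ds_a[OF st, of P\<^sub>2 P\<^sub>3 k\<^sub>2 k\<^sub>3]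
    by (simp_all add: st dsP on dtT has_real_derivative_iff_has_vector_derivative
        power2_eq_square algebra_simps)
  show ?thesis
  proof (rule conjI)
    show "\<forall>s\<in>I. \<forall>t\<in>J. (vector [ds T s t, ds P\<^sub>1 s t, ds P\<^sub>2 s t, ds P\<^sub>3 s t] :: real^4^4) =
      (vector [vector [0, k\<^sub>1 s t, k\<^sub>2 s t, k\<^sub>3 s t],
               vector [- k\<^sub>1 s t, 0, 0, 0],
               vector [- k\<^sub>2 s t, 0, 0, 0],
               vector [- k\<^sub>3 s t, 0, 0, 0]] :: real^4^4)
      ** (vector [T s t, P\<^sub>1 s t, P\<^sub>2 s t, P\<^sub>3 s t] :: real^4^4)"
      using row_ds by blast
  \<comment> \<open>The coefficients are the frame components of the \<open>t\<close>-derivatives;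
    no integral is formed, since \<open>a_ds\<close> already shows that the last three are
    antiderivatives.\<close>
  qed (rule exI[where x = "\<lambda>s t. dt T s t \<bullet> P\<^sub>1 s t"], rule exI[where x = "\<lambda>s t. dt T s t \<bullet> P\<^sub>2 s t"],
      rule exI[where x = "\<lambda>s t. dt T s t \<bullet> P\<^sub>3 s t"], rule exI[where x = "\<lambda>s t. dt P\<^sub>1 s t \<bullet> P\<^sub>2 s t"],
      rule exI[where x = "\<lambda>s t. dt P\<^sub>1 s t \<bullet> P\<^sub>3 s t"], rule exI[where x = "\<lambda>s t. dt P\<^sub>2 s t \<bullet> P\<^sub>3 s t"],
      intro ballI conjI row_dt dtT a_ds)
qed

end
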